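(* Let $E$ be a Fréchet space. The Hausdorff measure of noncompactness $\alpha$, defined over $E$, is indeed a measure of noncompactness, i.e., for all subsets $M \subseteq E$ we have $$\alpha(\mathrm{co}(M)) = \alpha(M).$$
   Context: A topological vector space $E$ is called metrizable if there exists a translation-invariant metric $d$ on $E$ (i.e., $d(x,y)=d(x+z,y+z)$ for all $x,y,z\in E$) inducing the topology of $E$. A Fréchet space is a complete and metrizable locally convex topological vector space; $d$ denotes a translation-invariant metric inducing its topology. For $M\subseteq E$, $\mathrm{co}(M)$ denotes the convex hull and $\overline{\mathrm{co}}(M)$ the closed convex hull. The Hausdorff measure of noncompactness of $M \subseteq E$ is $\alpha(M) := \inf\{\epsilon>0 \mid M \text{ has a finite } \epsilon\text{-net in } E\}$, where a finite $\epsilon$-net for $M$ in $E$ is a finite set $N\subseteq E$ such that every $x\in M$ has some $z\in N$ with $d(x,z)\le\epsilon$ (and $\inf\emptyset=\infty$). In general, for a locally convex space $E$ and a partially ordered set $(Q,\le)$, a map $\chi\colon 2^E\to Q$ is called a measure of noncompactness if $\chi(A)=\chi(\overline{\mathrm{co}}(A))$ for all $A\subseteq E$; note that $\alpha(\overline{A})=\alpha(A)$.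
   Formalization: The translation-invariant metric d is additionally assumed to have convex balls (every Fréchet space has such a metric); for arbitrary d the claim fails, e.g. on R^2 with d = min(1,|x1-y1|)+min(1,|x2-y2|) and M the union of the axes. *)

theory Defs
  imports "HOL-Analysis.Analysis"
begin

subsection \<open>Locally convex spaces and Frechet spaces\<close>

text \<open>Scalars are real. This covers complex spaces as well: convexity, the topology and
  translation invariance only involve the underlying real vector space.\<close>

class tvs = real_vector + topological_ab_group_add +
  assumes tendsto_scaleR_Pair:
    "LIM z (nhds (c::real) \<times>\<^sub>F nhds x). fst z *\<^sub>R snd z :> nhds (c *\<^sub>R x)"

text \<open>The global constant \<open>convex\<close> is not available in a class specification, so it is unfolded here;
  lemma \<open>locally_convex\<close> below is the folded form.\<close>

class locally_convex_space = tvs +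
  assumes locally_convex_unfolded:
    "open U \<Longrightarrow> 0 \<in> U \<Longrightarrow> \<exists>V. open V \<and> 0 \<in> V \<and> V \<subseteq> U \<and>
       (\<forall>x\<in>V. \<forall>y\<in>V. \<forall>u\<ge>0. \<forall>v\<ge>0. u + v = 1 \<longrightarrow> u *\<^sub>R x + v *\<^sub>R y \<in> V)"

lemma locally_convex:
  fixes U :: "'a::locally_convex_space set"
  assumes "open U" "0 \<in> U"
  shows "\<exists>V. open V \<and> 0 \<in> V \<and> convex V \<and> V \<subseteq> U"
  using locally_convex_unfolded[OF assms] unfolding convex_def by blast

definition (in ab_group_add) translation_invariant :: "('a \<Rightarrow> 'a \<Rightarrow> real) \<Rightarrow> bool" where
  "translation_invariant d \<longleftrightarrow> (\<forall>x y z. d x y = d (x + z) (y + z))"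

definition (in topological_space) metric_inducing_topology :: "('a \<Rightarrow> 'a \<Rightarrow> real) \<Rightarrow> bool" where
  "metric_inducing_topology d \<longleftrightarrow>
     Metric_space UNIV d \<and> (\<forall>U. openin (Metric_space.mtopology UNIV d) U \<longleftrightarrow> open U)"

text \<open>Completeness is that of the uniformity of the additive group: \<open>F\<close> is a Cauchy filter iff
  \<open>x - y\<close> tends to \<open>0\<close> along \<open>F \<times>\<^sub>F F\<close>.\<close>

class frechet_space = locally_convex_space +
  assumes metrizable: "\<exists>d. translation_invariant d \<and> metric_inducing_topology d"
    and Cauchy_filter_convergent: "F \<noteq> bot \<Longrightarrow> filterlim (\<lambda>(x, y). x - y) (nhds 0) (F \<times>\<^sub>F F)
                     \<Longrightarrow> \<exists>x. F \<le> nhds x"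


subsection \<open>Measures of noncompactness\<close>

definition finite_net :: "('a \<Rightarrow> 'a \<Rightarrow> real) \<Rightarrow> real \<Rightarrow> 'a set \<Rightarrow> 'a set \<Rightarrow> bool" where
  "finite_net d \<epsilon> N M \<longleftrightarrow> finite N \<and> (\<forall>x\<in>M. \<exists>z\<in>N. d x z \<le> \<epsilon>)"

definition hausdorff_mnc :: "('a \<Rightarrow> 'a \<Rightarrow> real) \<Rightarrow> 'a set \<Rightarrow> ereal" where
  "hausdorff_mnc d M = Inf {ereal \<epsilon> |\<epsilon>. \<epsilon> > 0 \<and> (\<exists>N. finite_net d \<epsilon> N M)}"

definition measure_of_noncompactness :: "('a::locally_convex_space set \<Rightarrow> 'q::order) \<Rightarrow> bool" where
  "measure_of_noncompactness \<gamma> \<longleftrightarrow> (\<forall>A. \<gamma> A = \<gamma> (closure (convex hull A)))"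


subsection \<open>Metrics with convex balls\<close>

text \<open>Local convexity does not make the balls of a given translation-invariant metric convex, and
  without convex balls \<open>hausdorff_mnc d\<close> need not be invariant under convex hulls
  (\<open>convex_balls_needed\<close>). The topology of every Frechet space is however induced by some
  translation-invariant metric with convex balls (\<open>convex_metric_exists\<close>).\<close>

lemma metric_inducing_topologyD:
  fixes d :: "'a::topological_space \<Rightarrow> 'a \<Rightarrow> real"
  assumes "metric_inducing_topology d"
  shows "Metric_space UNIV d" "open U \<longleftrightarrow> (\<forall>x\<in>U. \<exists>r>0. \<forall>y. d x y < r \<longrightarrow> y \<in> U)"
proof -
  show m: "Metric_space UNIV d" using assms unfolding metric_inducing_topology_def by blast
  then interpret Metric_space UNIV d .
  show "open U \<longleftrightarrow> (\<forall>x\<in>U. \<exists>r>0. \<forall>y. d x y < r \<longrightarrow> y \<in> U)"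
    using assms unfolding metric_inducing_topology_def openin_mtopology
    by (auto simp: mball_def subset_eq)
qed

lemma metric_inducing_topologyI:
  fixes d :: "'a::topological_space \<Rightarrow> 'a \<Rightarrow> real"
  assumes m: "Metric_space UNIV d"
    and "\<And>U. open U \<longleftrightarrow> (\<forall>x\<in>U. \<exists>r>0. \<forall>y. d x y < r \<longrightarrow> y \<in> U)"
  shows "metric_inducing_topology d"
proof -
  interpret Metric_space UNIV d by fact
  show ?thesis unfolding metric_inducing_topology_def openin_mtopology
    using assms by (auto simp: mball_def subset_eq)
qed

lemma mball_UNIV: "Metric_space UNIV d \<Longrightarrow> Metric_space.mball UNIV d x r = {y. d x y < r}"
  by (simp add: Metric_space.mball_def)


instance banach \<subseteq> frechet_space
proof
  fix c :: real and x :: 'a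
  show "LIM z (nhds c \<times>\<^sub>F nhds x). fst z *\<^sub>R snd z :> nhds (c *\<^sub>R x)"
    by (intro tendsto_scaleR) (auto simp: filterlim_fst filterlim_snd)
next
  fix U :: "'a set" assume "open U" "0 \<in> U"
  then obtain e where e: "e > 0" "ball 0 e \<subseteq> U" by (meson open_contains_ball)
  then show "\<exists>V. open V \<and> 0 \<in> V \<and> V \<subseteq> U \<and>
       (\<forall>x\<in>V. \<forall>y\<in>V. \<forall>u\<ge>0. \<forall>v\<ge>0. u + v = 1 \<longrightarrow> u *\<^sub>R x + v *\<^sub>R y \<in> V)"
    using convex_ball[of "0::'a" e] unfolding convex_def
    by (intro exI[of _ "ball 0 e"]) auto
next
  show "\<exists>d::'a\<Rightarrow>'a\<Rightarrow>real. translation_invariant d \<and> metric_inducing_topology d"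
  proof (intro exI conjI)
    show "translation_invariant (dist::'a\<Rightarrow>'a\<Rightarrow>real)" by (simp add: translation_invariant_def)
    show "metric_inducing_topology (dist::'a\<Rightarrow>'a\<Rightarrow>real)"
      by (rule metric_inducing_topologyI) (auto simp: open_dist dist_commute Met_TC.Metric_space_axioms)
  qed
next
  fix F :: "'a filter"
  assume F: "F \<noteq> bot" and C: "filterlim (\<lambda>(x, y). x - y) (nhds 0) (F \<times>\<^sub>F F)"
  have "cauchy_filter F"
    unfolding cauchy_filter_metric
  proof (intro allI impI)
    fix e :: real assume "e > 0"
    then have "\<forall>\<^sub>F z in F \<times>\<^sub>F F. dist (case z of (x,y) \<Rightarrow> x - y) 0 < e"
      using C by (simp add: tendsto_iff)
    then obtain P where "eventually P F" "\<And>x y. P x \<Longrightarrow> P y \<Longrightarrow> dist (x - y) 0 < e"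
      unfolding eventually_prod_same by (metis (mono_tags, lifting) case_prod_conv)
    then show "\<exists>P. eventually P F \<and> (\<forall>x y. P x \<and> P y \<longrightarrow> dist x y < e)"
      by (auto simp: dist_norm)
  qed
  moreover have "complete (UNIV::'a set)" by (simp add: complete_UNIV)
  ultimately show "\<exists>x. F \<le> nhds x"
    using F by (auto simp: complete_uniform)
qed


lemma convex_balls_needed:
  "\<exists>d :: real \<times> real \<Rightarrow> real \<times> real \<Rightarrow> real. translation_invariant d \<and> metric_inducing_topology d
     \<and> (\<exists>M. hausdorff_mnc d (convex hull M) \<noteq> hausdorff_mnc d M)"
proof (intro exI conjI)
  define d :: "real \<times> real \<Rightarrow> real \<times> real \<Rightarrow> real" where
    "d = (\<lambda>p q. min 1 \<bar>fst p - fst q\<bar> + min 1 \<bar>snd p - snd q\<bar>)"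
  define M :: "(real \<times> real) set" where "M = {p. fst p = 0 \<or> snd p = 0}"
  show "translation_invariant d" by (simp add: translation_invariant_def d_def)
  have m: "Metric_space UNIV d"
  proof
    show "d x y = d y x" for x y by (simp add: d_def abs_minus_commute)
    show "0 \<le> d x y" for x y by (simp add: d_def)
    show "d x y = 0 \<longleftrightarrow> x = y" for x y
      by (auto simp: d_def min_def prod_eq_iff split: if_splits)
    show "d x z \<le> d x y + d y z" for x y z
    proof -
      have h: "min 1 \<bar>a - c\<bar> \<le> min 1 \<bar>a - b\<bar> + min 1 \<bar>b - c\<bar>" for a b c :: real
        by linarith
      show ?thesis
        using add_mono[OF h[of "fst x" "fst z" "fst y"] h[of "snd x" "snd z" "snd y"]]
        by (simp add: d_def algebra_simps)
    qed
  qed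
  show "metric_inducing_topology d"
  proof (rule metric_inducing_topologyI[OF m])
    fix U :: "(real \<times> real) set"
    have 1: "d x y \<le> 2 * dist y x" for x y
      using abs_le_square_iff[of "fst x - fst y" "dist y x"] dist_fst_le[of y x] dist_snd_le[of y x]
      by (auto simp: d_def dist_real_def min_def)
    have 2: "dist y x < e" if "d x y < min 1 (e/2)" for x y e
    proof -
      have "dist y x \<le> \<bar>fst x - fst y\<bar> + \<bar>snd x - snd y\<bar>"
        using sqrt_sum_squares_le_sum_abs[of "fst y - fst x" "snd y - snd x"]
        by (simp add: dist_prod_def dist_real_def)
      moreover have "a + b < e" if "min 1 a + min 1 b < min 1 (e/2)" "a \<ge> 0" "b \<ge> 0" for a b :: real
        using that by (auto simp: min_def split: if_splits)
      ultimately show ?thesis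
        using that[unfolded d_def] by (meson abs_ge_zero order_le_less_trans)
    qed
    show "open U \<longleftrightarrow> (\<forall>x\<in>U. \<exists>r>0. \<forall>y. d x y < r \<longrightarrow> y \<in> U)"
      unfolding open_dist
    proof (intro ball_cong refl iffI)
      fix x assume "\<exists>e>0. \<forall>y. dist y x < e \<longrightarrow> y \<in> U"
      then obtain e where e: "e > 0" "\<And>y. dist y x < e \<Longrightarrow> y \<in> U" by blast
      then show "\<exists>r>0. \<forall>y. d x y < r \<longrightarrow> y \<in> U"
        using 2[of x _ e] by (intro exI[of _ "min 1 (e/2)"]) auto
    next
      fix x assume "\<exists>r>0. \<forall>y. d x y < r \<longrightarrow> y \<in> U"
      then obtain r where r: "r > 0" "\<And>y. d x y < r \<Longrightarrow> y \<in> U" by blast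
      have "y \<in> U" if "dist y x < r / 2" for y using 1[of x y] that by (intro r) auto
      then show "\<exists>e>0. \<forall>y. dist y x < e \<longrightarrow> y \<in> U" using r by (intro exI[of _ "r/2"]) auto
    qed
  qed
  have "finite_net d 1 {0} M" by (auto simp: finite_net_def M_def d_def)
  then have "hausdorff_mnc d M \<le> ereal 1"
    unfolding hausdorff_mnc_def by (intro Inf_lower) (auto intro!: exI[of _ 1])
  moreover have "ereal 2 \<le> hausdorff_mnc d (convex hull M)"
    unfolding hausdorff_mnc_def
  proof (rule Inf_greatest, safe)
    fix e N assume N: "finite_net d e N (convex hull M)"
    define t where "t = 1 + (\<Sum>z\<in>N. \<bar>fst z\<bar> + \<bar>snd z\<bar>)"
    have "(1/2) *\<^sub>R (2*t, 0::real) + (1/2) *\<^sub>R (0, 2*t) \<in> convex hull M"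
      by (rule convexD[OF convex_convex_hull]) (auto intro!: hull_inc simp: M_def)
    then have "(t, t) \<in> convex hull M" by simp
    then obtain z where z: "z \<in> N" "d (t, t) z \<le> e" using N by (auto simp: finite_net_def)
    have "\<bar>fst z\<bar> + \<bar>snd z\<bar> \<le> (\<Sum>z\<in>N. \<bar>fst z\<bar> + \<bar>snd z\<bar>)"
      using N z(1) by (intro member_le_sum) (auto simp: finite_net_def)
    then have "\<bar>t - fst z\<bar> \<ge> 1" "\<bar>t - snd z\<bar> \<ge> 1" by (auto simp: t_def)
    then have "d (t, t) z = 2" by (simp add: d_def)
    then show "ereal 2 \<le> ereal e" using z by simp
  qed
  ultimately show "hausdorff_mnc d (convex hull M) \<noteq> hausdorff_mnc d M"
    using order_trans[of "ereal 2" "hausdorff_mnc d M" "ereal 1"] by auto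
qed

lemma open_dilation:
  fixes W :: "'a::tvs set"
  assumes "open W"
  shows "open {y. c *\<^sub>R (y - x) \<in> W}"
proof -
  have "((\<lambda>y. c *\<^sub>R (y - x)) \<longlongrightarrow> c *\<^sub>R (a - x)) (nhds a)" for a
  proof -
    have "((\<lambda>y. (y - x)) \<longlongrightarrow> (a - x)) (nhds a)"
      using tendsto_add[OF filterlim_ident[of "nhds a"] tendsto_const[of "-x"]] by simp
    then have "LIM y nhds a. (c, y - x) :> nhds c \<times>\<^sub>F nhds (a - x)"
      by (intro filterlim_Pair) auto
    from filterlim_compose[OF tendsto_scaleR_Pair this] show ?thesis by simp
  qed
  then have "\<forall>\<^sub>F y in nhds a. c *\<^sub>R (y - x) \<in> W" if "c *\<^sub>R (a - x) \<in> W" for a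
    using that assms by (auto simp: tendsto_def)
  then have "\<exists>T. open T \<and> a \<in> T \<and> T \<subseteq> {y. c *\<^sub>R (y - x) \<in> W}"
    if "c *\<^sub>R (a - x) \<in> W" for a
    using that unfolding eventually_nhds subset_eq mem_Collect_eq by blast
  then show ?thesis by (intro iffD2[OF open_subopen]) auto
qed

lemma absorbing:
  fixes W :: "'a::tvs set"
  assumes "open W" "0 \<in> W"
  shows "\<exists>t>0. (1/t) *\<^sub>R x \<in> W"
proof -
  have "LIM c nhds (0::real). (c, x) :> nhds 0 \<times>\<^sub>F nhds x"
    by (intro filterlim_Pair filterlim_ident) auto
  from filterlim_compose[OF tendsto_scaleR_Pair this]
  have "((\<lambda>c. c *\<^sub>R x) \<longlongrightarrow> 0) (nhds 0)" by simp
  then have "\<forall>\<^sub>F c in nhds (0::real). c *\<^sub>R x \<in> W" using assms by (auto simp: tendsto_def)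
  then obtain e where e: "e > 0" "\<And>c::real. dist c 0 < e \<Longrightarrow> c *\<^sub>R x \<in> W"
    unfolding eventually_nhds_metric by blast
  then show ?thesis by (intro exI[of _ "2/e"]) auto
qed

definition gauge_fun :: "'a::real_vector set \<Rightarrow> 'a \<Rightarrow> real" where
  "gauge_fun W x = Inf {t. t > 0 \<and> (1/t) *\<^sub>R x \<in> W}"

lemma gauge_fun:
  fixes W :: "'a::tvs set"
  assumes W: "open W" "0 \<in> W" "convex W" and sym: "\<forall>x\<in>W. - x \<in> W"
  shows gauge_nonneg: "gauge_fun W x \<ge> 0"
    and gauge_le: "t > 0 \<Longrightarrow> (1/t) *\<^sub>R x \<in> W \<Longrightarrow> gauge_fun W x \<le> t"
    and gauge_less: "gauge_fun W x < t \<Longrightarrow> (1/t) *\<^sub>R x \<in> W"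
    and gauge_zero: "gauge_fun W 0 = 0"
    and gauge_uminus: "gauge_fun W (- x) = gauge_fun W x"
    and gauge_add: "gauge_fun W (x + y) \<le> gauge_fun W x + gauge_fun W y"
    and gauge_conv: "u \<ge> 0 \<Longrightarrow> v \<ge> 0 \<Longrightarrow> u + v = 1 \<Longrightarrow>
       gauge_fun W (u *\<^sub>R x + v *\<^sub>R y) \<le> max (gauge_fun W x) (gauge_fun W y)"
proof -
  have ne: "{t. t > 0 \<and> (1/t) *\<^sub>R x \<in> W} \<noteq> {}" for x using absorbing[OF W(1,2), of x] by auto
  have bb: "bdd_below {t. t > 0 \<and> (1/t) *\<^sub>R x \<in> W}" for x by (rule bdd_belowI[of _ 0]) auto
  show n: "gauge_fun W x \<ge> 0" for x
    unfolding gauge_fun_def by (rule cInf_greatest[OF ne]) auto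
  show le: "gauge_fun W x \<le> t" if "t > 0" "(1/t) *\<^sub>R x \<in> W" for t x
    unfolding gauge_fun_def by (rule cInf_lower[OF _ bb]) (use that in auto)
  show less: "(1/t) *\<^sub>R x \<in> W" if "gauge_fun W x < t" for t x
  proof -
    obtain s where s: "s > 0" "(1/s) *\<^sub>R x \<in> W" "s < t"
      using \<open>gauge_fun W x < t\<close> ne[of x] bb[of x] unfolding gauge_fun_def cInf_less_iff[OF ne bb] by auto
    have "(s/t) *\<^sub>R ((1/s) *\<^sub>R x) + (1 - s/t) *\<^sub>R 0 \<in> W"
      by (rule convexD[OF W(3)]) (use s W in auto)
    then show ?thesis using s by simp
  qed
  show "gauge_fun W 0 = 0"
  proof (rule antisym[OF _ n])
    show "gauge_fun W 0 \<le> 0" by (rule field_le_epsilon) (auto intro!: le W)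
  qed
  have "(1/t) *\<^sub>R (- x) \<in> W \<longleftrightarrow> (1/t) *\<^sub>R x \<in> W" for t x
    using bspec[OF sym, of "(1/t) *\<^sub>R x"] bspec[OF sym, of "-((1/t) *\<^sub>R x)"] by auto
  then show "gauge_fun W (- x) = gauge_fun W x" unfolding gauge_fun_def by simp
  show "gauge_fun W (x + y) \<le> gauge_fun W x + gauge_fun W y"
  proof (rule field_le_epsilon)
    fix e :: real assume "e > 0"
    define s t where st: "s = gauge_fun W x + e/2" "t = gauge_fun W y + e/2"
    have p: "s > 0" "t > 0" using n[of x] n[of y] \<open>e > 0\<close> by (auto simp: st)
    have w: "(1/s) *\<^sub>R x \<in> W" "(1/t) *\<^sub>R y \<in> W" using \<open>e > 0\<close> by (auto intro!: less simp: st)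
    have "(s/(s+t)) *\<^sub>R ((1/s) *\<^sub>R x) + (t/(s+t)) *\<^sub>R ((1/t) *\<^sub>R y) \<in> W"
      by (rule convexD[OF W(3)]) (use w p in \<open>auto simp: add_divide_distrib[symmetric]\<close>)
    then have "(1/(s+t)) *\<^sub>R (x + y) \<in> W" using p by (simp add: scaleR_add_right)
    then have "gauge_fun W (x + y) \<le> s + t" using p by (intro le) auto
    then show "gauge_fun W (x + y) \<le> gauge_fun W x + gauge_fun W y + e" by (simp add: st)
  qed
  assume uv: "u \<ge> 0" "v \<ge> 0" "u + v = 1"
  show "gauge_fun W (u *\<^sub>R x + v *\<^sub>R y) \<le> max (gauge_fun W x) (gauge_fun W y)"
  proof (rule field_le_epsilon)
    fix e :: real assume "e > 0"
    define t where "t = max (gauge_fun W x) (gauge_fun W y) + e"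
    have "t > 0" using n[of x] \<open>e > 0\<close> by (auto simp: t_def)
    have "u *\<^sub>R ((1/t) *\<^sub>R x) + v *\<^sub>R ((1/t) *\<^sub>R y) \<in> W"
      by (rule convexD[OF W(3)]) (use uv \<open>e > 0\<close> in \<open>auto intro!: less simp: t_def\<close>)
    then have "(1/t) *\<^sub>R (u *\<^sub>R x + v *\<^sub>R y) \<in> W" by (simp add: scaleR_add_right mult.commute)
    then show "gauge_fun W (u *\<^sub>R x + v *\<^sub>R y) \<le> max (gauge_fun W x) (gauge_fun W y) + e"
      using le \<open>t > 0\<close> unfolding t_def by blast
  qed
qed

lemma convex_metric_exists:
  "\<exists>d :: 'a::frechet_space \<Rightarrow> 'a \<Rightarrow> real. translation_invariant d \<and> metric_inducing_topology d
     \<and> (\<forall>x r. convex (Metric_space.mball UNIV d x r))"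
proof -
  obtain d0 :: "'a \<Rightarrow> 'a \<Rightarrow> real" where ti: "translation_invariant d0" and mi: "metric_inducing_topology d0"
    using metrizable by blast
  interpret d0: Metric_space UNIV d0 using mi by (rule metric_inducing_topologyD)
  have top0: "open U \<longleftrightarrow> (\<forall>x\<in>U. \<exists>r>0. \<forall>y. d0 x y < r \<longrightarrow> y \<in> U)" for U
    using mi by (rule metric_inducing_topologyD)
  have d0_0: "d0 x y = d0 0 (y - x)" for x y
    using ti[unfolded translation_invariant_def, rule_format, of x y "-x"] by simp
  define b :: "nat \<Rightarrow> real" where "b n = 1 / (real n + 1)" for n
  have b: "b n > 0" "b n \<le> 1" for n by (auto simp: b_def)
  have b0: "\<exists>n. b n < e" if "e > 0" for e
    using reals_Archimedean[OF that] by (auto simp: b_def inverse_eq_divide add.commute)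
  have b_mono: "b n \<le> b m" if "m \<le> n" for m n using that by (auto simp: b_def field_simps)
  have "open {y. d0 0 y < r}" for r
    unfolding top0
  proof safe
    fix x assume "d0 0 x < r"
    then show "\<exists>s>0. \<forall>y. d0 x y < s \<longrightarrow> y \<in> {y. d0 0 y < r}"
      using d0.triangle[of 0 x] by (intro exI[of _ "r - d0 0 x"]) (auto, smt (verit))
  qed
  then have "\<exists>V. open V \<and> 0 \<in> V \<and> convex V \<and> V \<subseteq> {y. d0 0 y < b n}" for n
    using b(1) by (intro locally_convex) auto
  then obtain V where V: "\<And>n. open (V n)" "\<And>n. 0 \<in> V n" "\<And>n. convex (V n)" "\<And>n. V n \<subseteq> {y. d0 0 y < b n}"
    by metis
  define W where "W n = V n \<inter> {y. (-1) *\<^sub>R (y - 0) \<in> V n}" for n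
  have W: "open (W n)" "0 \<in> W n" "W n \<subseteq> {y. d0 0 y < b n}" "\<forall>x\<in>W n. - x \<in> W n" for n
    using V[of n] by (auto simp: W_def intro!: open_Int open_dilation[of _ "-1" 0, simplified])
  have Wc: "convex (W n)" for n
  proof -
    have "{y. (-1) *\<^sub>R (y - 0) \<in> V n} = uminus ` V n" by (force simp: image_iff)
    then show ?thesis unfolding W_def using V(3)[of n] by (auto intro!: convex_Int convex_negations)
  qed
  define p where "p n = gauge_fun (W n)" for n
  note g = gauge_fun[OF W(1,2) Wc W(4), folded p_def]
  define q where "q x = (SUP n. min (p n x) (b n))" for x
  have bdd: "bdd_above (range (\<lambda>n. min (p n x) (b n)))" for x
    by (rule bdd_aboveI[of _ 1]) (use b(2) in \<open>auto simp: min_le_iff_disj\<close>)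
  have q_up: "min (p n x) (b n) \<le> q x" for n x
    unfolding q_def by (rule cSUP_upper[OF _ bdd]) simp
  have q_least: "q x \<le> c" if "\<And>n. min (p n x) (b n) \<le> c" for x c
    unfolding q_def by (rule cSUP_least) (use that in auto)
  have q_nonneg: "q x \<ge> 0" for x using q_up[of 0 x] g(1)[of 0 x] b(1)[of 0] by linarith
  have q_zero: "q 0 = 0" by (rule antisym[OF q_least q_nonneg]) (simp add: g(4) less_imp_le[OF b(1)])
  have q_minus: "q (- x) = q x" for x by (simp add: q_def g(5))
  have q_add: "q (x + y) \<le> q x + q y" for x y
  proof (rule q_least)
    fix n show "min (p n (x + y)) (b n) \<le> q x + q y"
      using q_up[of n x] q_up[of n y] g(6)[of n x y] g(1)[of n x] g(1)[of n y] b(1)[of n] by linarith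
  qed
  have q_conv: "q (u *\<^sub>R x + v *\<^sub>R y) \<le> max (q x) (q y)" if "u \<ge> 0" "v \<ge> 0" "u + v = 1" for u v x y
  proof (rule q_least)
    fix n show "min (p n (u *\<^sub>R x + v *\<^sub>R y)) (b n) \<le> max (q x) (q y)"
      using q_up[of n x] q_up[of n y] g(7)[OF that, of n x y] by linarith
  qed
  have q_small: "d0 0 x < b n" if "q x < b n" for x n
  proof -
    have "p n x < 1" using q_up[of n x] that b(2)[of n] by linarith
    from g(3)[OF this] show ?thesis using W(3)[of n] by auto
  qed
  have q_eq0: "x = 0" if "q x = 0" for x
  proof (rule ccontr)
    assume "x \<noteq> 0"
    then have "d0 0 x > 0" using d0.zero[of 0 x] d0.nonneg[of 0 x] by (simp add: less_le)
    then obtain n where "b n < d0 0 x" using b0 by blast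
    then show False using q_small[of x n] that b(1)[of n] by simp
  qed
  define d where "d x y = q (y - x)" for x y
  have m: "Metric_space UNIV d"
  proof
    show "0 \<le> d x y" for x y by (simp add: d_def q_nonneg)
    show "d x y = d y x" for x y using q_minus[of "y - x"] by (simp add: d_def)
    show "d x y = 0 \<longleftrightarrow> x = y" for x y using q_eq0[of "y - x"] by (auto simp: d_def q_zero)
    show "d x z \<le> d x y + d y z" for x y z using q_add[of "y - x" "z - y"] by (simp add: d_def)
  qed
  have "translation_invariant d" by (simp add: translation_invariant_def d_def)
  moreover have "metric_inducing_topology d"
  proof (rule metric_inducing_topologyI[OF m iffI])
    fix U :: "'a set" assume "open U"
    show "\<forall>x\<in>U. \<exists>r>0. \<forall>y. d x y < r \<longrightarrow> y \<in> U"
    proof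
      fix x assume "x \<in> U"
      then obtain r where r: "r > 0" "\<And>y. d0 x y < r \<Longrightarrow> y \<in> U" using \<open>open U\<close> top0 by blast
      obtain n where n: "b n < r" using b0 r by blast
      have "y \<in> U" if "d x y < b n" for y
        using q_small[of "y - x" n] that n by (intro r) (simp add: d_def d0_0[of x y])
      then show "\<exists>r>0. \<forall>y. d x y < r \<longrightarrow> y \<in> U" using b(1) by blast
    qed
  next
    fix U :: "'a set" assume U: "\<forall>x\<in>U. \<exists>r>0. \<forall>y. d x y < r \<longrightarrow> y \<in> U"
    show "open U"
    proof (rule iffD2[OF open_subopen], rule ballI)
      fix x assume "x \<in> U"
      then obtain r where r: "r > 0" "\<And>y. d x y < r \<Longrightarrow> y \<in> U" using U by blast
      obtain n where n: "b n < r" using b0 r by blast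
      define T where "T = (\<Inter>m\<in>{..n}. {y. (1/(r/2)) *\<^sub>R (y - x) \<in> W m})"
      have "open T" unfolding T_def using W(1) by (blast intro: open_INT open_dilation finite_atMost)
      moreover have "x \<in> T" using W(2) by (simp add: T_def)
      moreover have "T \<subseteq> U"
      proof
        fix y assume y: "y \<in> T"
        have "q (y - x) \<le> max (r/2) (b n)"
        proof (rule q_least)
          fix m show "min (p m (y - x)) (b m) \<le> max (r/2) (b n)"
          proof (cases "m \<le> n")
            case True
            then have "(1/(r/2)) *\<^sub>R (y - x) \<in> W m" using y by (auto simp: T_def)
            then have "p m (y - x) \<le> r/2" using r(1) by (intro g(2)) auto
            then show ?thesis by auto
          next
            case False
            then show ?thesis using b_mono[of n m] by auto
          qed
        qed
        then have "d x y < r" using n r(1) by (auto simp: d_def)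
        then show "y \<in> U" by (rule r(2))
      qed
      ultimately show "\<exists>T. open T \<and> x \<in> T \<and> T \<subseteq> U" by blast
    qed
  qed
  moreover have "convex (Metric_space.mball UNIV d x r)" for x r
    unfolding mball_UNIV[OF m]
  proof (rule convexI)
    fix y z and u v :: real
    assume yz: "y \<in> {y. d x y < r}" "z \<in> {y. d x y < r}" and uv: "u \<ge> 0" "v \<ge> 0" "u + v = 1"
    have "u *\<^sub>R y + v *\<^sub>R z - x = u *\<^sub>R (y - x) + v *\<^sub>R (z - x)"
    proof -
      have "u *\<^sub>R x + v *\<^sub>R x = x" using uv(3) by (simp flip: scaleR_add_left)
      moreover have "u *\<^sub>R (y - x) + v *\<^sub>R (z - x) = u *\<^sub>R y + v *\<^sub>R z - (u *\<^sub>R x + v *\<^sub>R x)"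
        by (simp add: scaleR_diff_right)
      ultimately show ?thesis by simp
    qed
    then show "u *\<^sub>R y + v *\<^sub>R z \<in> {y. d x y < r}"
      using q_conv[OF uv, of "y - x" "z - x"] yz by (auto simp: d_def)
  qed
  ultimately show ?thesis by (intro exI[of _ d] conjI allI)
qed

end

(* A finite eps-net N of M gives the convex set of all points within eps of the convex hull of N,
   and this set contains the convex hull of M. The convex hull of a finite set is totally bounded,
   so the convex hull of M has a finite (eps + delta)-net for every delta > 0. Passing to the
   closure costs another delta. *)

theory Submission
  imports Defs
begin

lemma finite_net_subset: "finite_net d \<epsilon> N B \<Longrightarrow> A \<subseteq> B \<Longrightarrow> finite_net d \<epsilon> N A"
  unfolding finite_net_def by blast

lemma hausdorff_mnc_mono:
  assumes "A \<subseteq> B"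
  shows "hausdorff_mnc d A \<le> hausdorff_mnc d B"
  unfolding hausdorff_mnc_def
  by (rule Inf_superset_mono) (use finite_net_subset[OF _ assms] in blast)

text \<open>Since \<alpha> is an infimum, a loss of \<delta> in the radius costs nothing once
  \<delta> tends to 0. Every nontrivial inequality below goes through this rule.\<close>

lemma hausdorff_mnc_leI:
  assumes "\<And>\<epsilon> \<delta> N. \<epsilon> > 0 \<Longrightarrow> \<delta> > 0 \<Longrightarrow> finite_net d \<epsilon> N A \<Longrightarrow> \<exists>N'. finite_net d (\<epsilon> + \<delta>) N' B"
  shows "hausdorff_mnc d B \<le> hausdorff_mnc d A"
  unfolding hausdorff_mnc_def[of d A]
proof (rule Inf_greatest, safe)
  fix \<epsilon> :: real and N assume N: "\<epsilon> > 0" "finite_net d \<epsilon> N A"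
  show "hausdorff_mnc d B \<le> ereal \<epsilon>"
  proof (rule ereal_le_epsilon2)
    fix \<delta> :: real assume "\<delta> > 0"
    then show "hausdorff_mnc d B \<le> ereal \<epsilon> + ereal \<delta>"
      using assms[OF N(1) _ N(2)] N(1) unfolding hausdorff_mnc_def
      by (intro Inf_lower) (auto intro!: exI[of _ "\<epsilon> + \<delta>"])
  qed
qed

text \<open>Convexity of the balls stands in for the homogeneity of a norm: it controls both convex
  combinations and the shrinking of vectors towards 0.\<close>

locale convex_invariant_metric =
  fixes d :: "'a::tvs \<Rightarrow> 'a \<Rightarrow> real"
  assumes invariant: "translation_invariant d"
    and inducing: "metric_inducing_topology d"
    and convex_mball: "\<And>x r. convex (Metric_space.mball UNIV d x r)"
begin

sublocale Metric_space UNIV d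
  using inducing by (rule metric_inducing_topologyD)

lemma dist_eq: "d x y = d 0 (y - x)"
  using invariant[unfolded translation_invariant_def, rule_format, of x y "-x"] by simp

lemma open_dist_less: "open {y. d x y < r}"
  using inducing openin_mball[of x r]
  unfolding metric_inducing_topology_def mball_UNIV[OF Metric_space_axioms] by blast

lemma convex_dist_less: "convex {y. d x y < r}"
  using convex_mball[of x r] unfolding mball_UNIV[OF Metric_space_axioms] .

text \<open>By invariance \<open>z - x\<close> and \<open>z' - x'\<close> lie in the open ball of
  radius \<open>s\<close> about 0 for each \<open>s > r\<close>. That ball is convex, so it contains
  their combination; then let \<open>s\<close> decrease to \<open>r\<close>.\<close>

lemma dist_convex_combination_le:
  assumes "d x z \<le> r" "d x' z' \<le> r" and uv: "u \<ge> 0" "v \<ge> 0" "u + v = 1"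
  shows "d (u *\<^sub>R x + v *\<^sub>R x') (u *\<^sub>R z + v *\<^sub>R z') \<le> r"
proof (rule dense_ge)
  fix s assume "r < s"
  then have "z - x \<in> {y. d 0 y < s}" "z' - x' \<in> {y. d 0 y < s}"
    using assms(1,2) by (auto simp: dist_eq[of x] dist_eq[of x'])
  from convexD[OF convex_dist_less this uv]
  have "d 0 ((u *\<^sub>R z + v *\<^sub>R z') - (u *\<^sub>R x + v *\<^sub>R x')) < s"
    by (simp add: algebra_simps)
  then show "d (u *\<^sub>R x + v *\<^sub>R x') (u *\<^sub>R z + v *\<^sub>R z') \<le> s"
    by (simp add: dist_eq[of "u *\<^sub>R x + v *\<^sub>R x'"])
qed

lemma convex_dist_le_thickening:
  assumes "convex S"
  shows "convex {x. \<exists>z\<in>S. d x z \<le> r}"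
proof (rule convexI, safe)
  fix x x' z z' and u v :: real
  assume *: "z \<in> S" "d x z \<le> r" "z' \<in> S" "d x' z' \<le> r" "u \<ge> 0" "v \<ge> 0" "u + v = 1"
  then show "\<exists>y\<in>S. d (u *\<^sub>R x + v *\<^sub>R x') y \<le> r"
    by (intro bexI[of _ "u *\<^sub>R z + v *\<^sub>R z'"] dist_convex_combination_le convexD[OF assms])
qed

text \<open>The ball of radius \<delta> about 0 is absorbing, so it contains
  \<open>(1/t) *\<^sub>R x\<close> for some \<open>t > 0\<close>. Cutting the segment into
  \<open>n\<close> equal pieces with \<open>n\<close> at least \<open>t\<close> makes each piece
  short enough.\<close>

lemma finite_net_segment:
  assumes "\<delta> > 0"
  shows "\<exists>N. finite_net d \<delta> N ((\<lambda>v. a + v *\<^sub>R x) ` {0..1})"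
proof -
  obtain t where t: "t > 0" "(1/t) *\<^sub>R x \<in> {y. d 0 y < \<delta>}"
    using absorbing[OF open_dist_less[of 0 \<delta>], of x] assms by auto
  obtain n :: nat where n: "n > 0" "t \<le> n"
    using t(1) real_arch_simple[of t] by (metis less_le_trans of_nat_0_less_iff)
  define N where "N = (\<lambda>k. a + (real k / n) *\<^sub>R x) ` {..n}"
  have "\<exists>z\<in>N. d (a + v *\<^sub>R x) z \<le> \<delta>" if v: "v \<in> {0..1}" for v
  proof
    \<comment> \<open>Round \<open>v\<close> down to the grid of mesh \<open>1/n\<close>.\<close>
    define k where "k = nat \<lfloor>v * n\<rfloor>"
    have k: "real k \<le> v * n" "v * n < real k + 1"
      using v by (auto simp: k_def)
    have "v * n \<le> n" using v by (auto intro: mult_left_le_one_le)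
    then show "a + (real k / n) *\<^sub>R x \<in> N"
      using k(1) by (auto simp: N_def)
    define s where "s = v - real k / n"
    have "s \<ge> 0" using k n by (simp add: s_def field_simps)
    have "s * n = v * n - k" using n by (simp add: s_def left_diff_distrib)
    then have "s * n \<le> 1" using k by simp
    moreover have "s * t \<le> s * n" using n \<open>s \<ge> 0\<close> by (intro mult_left_mono)
    \<comment> \<open>Since \<open>s * t\<close> is at most 1, \<open>s *\<^sub>R x\<close> is a
      convex combination of \<open>(1/t) *\<^sub>R x\<close> and 0, both in the convex ball.\<close>
    ultimately have "(s * t) *\<^sub>R ((1/t) *\<^sub>R x) + (1 - s * t) *\<^sub>R 0 \<in> {y. d 0 y < \<delta>}"
      using t assms \<open>s \<ge> 0\<close> by (intro convexD[OF convex_dist_less]) auto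
    then have "d 0 (s *\<^sub>R x) < \<delta>" using t by simp
    moreover have "d (a + v *\<^sub>R x) (a + (real k / n) *\<^sub>R x) = d 0 (s *\<^sub>R x)"
      \<comment> \<open>Swapping the arguments first makes the difference
        \<open>s *\<^sub>R x\<close> instead of its negative.\<close>
      by (subst commute) (subst dist_eq, simp add: s_def algebra_simps)
    ultimately show "d (a + v *\<^sub>R x) (a + (real k / n) *\<^sub>R x) \<le> \<delta>" by simp
  qed
  then have "finite_net d \<delta> N ((\<lambda>v. a + v *\<^sub>R x) ` {0..1})"
    by (auto simp: finite_net_def N_def)
  then show ?thesis ..
qed

lemma finite_net_UN:
  assumes "finite I" "\<And>i. i \<in> I \<Longrightarrow> \<exists>N. finite_net d \<epsilon> N (S i)"
  shows "\<exists>N. finite_net d \<epsilon> N (\<Union>i\<in>I. S i)"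
proof -
  obtain N where "\<And>i. i \<in> I \<Longrightarrow> finite_net d \<epsilon> (N i) (S i)" using assms(2) by metis
  then have "finite_net d \<epsilon> (\<Union>i\<in>I. N i) (\<Union>i\<in>I. S i)"
    using assms(1) unfolding finite_net_def by blast
  then show ?thesis ..
qed

lemma finite_net_thickening:
  assumes "finite_net d \<delta> N A" "\<And>x. x \<in> B \<Longrightarrow> \<exists>y\<in>A. d x y \<le> \<epsilon>"
  shows "finite_net d (\<epsilon> + \<delta>) N B"
  unfolding finite_net_def
proof safe
  show "finite N" using assms(1) by (simp add: finite_net_def)
  fix x assume "x \<in> B"
  then obtain y z where "y \<in> A" "d x y \<le> \<epsilon>" "z \<in> N" "d y z \<le> \<delta>"
    using assms unfolding finite_net_def by meson
  then show "\<exists>z\<in>N. d x z \<le> \<epsilon> + \<delta>"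
    using triangle[of x y z] by (intro bexI[of _ z]) auto
qed

text \<open>Each point of the new hull lies on a segment from \<open>a\<close> to some
  \<open>b\<close> in the old hull. Replacing \<open>b\<close> by a nearby net point moves it by at
  most \<open>\<delta>/2\<close> and leaves only finitely many segments to cover, each with the
  other \<open>\<delta>/2\<close>.\<close>

lemma finite_net_convex_hull_finite:
  assumes "finite S" "\<delta> > 0"
  shows "\<exists>N. finite_net d \<delta> N (convex hull S)"
  using assms
proof (induction S arbitrary: \<delta> rule: finite_induct)
  case empty
  then show ?case by (auto simp: finite_net_def)
next
  case (insert a S)
  show ?case
  \<comment> \<open>The description of the hull by segments from \<open>a\<close> needs
    \<open>S\<close> nonempty; otherwise the hull is just \<open>{a}\<close>.\<close>
  proof (cases "S = {}")
    case True
    then show ?thesis using \<open>\<delta> > 0\<close> by (auto simp: finite_net_def intro!: exI[of _ "{a}"])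
  next
    case False
    obtain F where F: "finite_net d (\<delta>/2) F (convex hull S)"
      using insert.IH[of "\<delta>/2"] insert.prems by auto
    define T where "T = (\<Union>z\<in>F. (\<lambda>v. a + v *\<^sub>R (z - a)) ` {0..1})"
    have "\<exists>N. finite_net d (\<delta>/2) N T"
      unfolding T_def
    proof (rule finite_net_UN)
      show "finite F" using F by (simp add: finite_net_def)
    qed (use insert.prems in \<open>intro finite_net_segment, simp\<close>)
    then obtain N where N: "finite_net d (\<delta>/2) N T" ..
    have "\<exists>y\<in>T. d x y \<le> \<delta>/2" if x: "x \<in> convex hull (insert a S)" for x
    proof -
      obtain u v b where b: "u \<ge> 0" "v \<ge> 0" "u + v = 1" "b \<in> convex hull S"
        "x = u *\<^sub>R a + v *\<^sub>R b"
        using x unfolding convex_hull_insert[OF False] by auto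
      obtain z where z: "z \<in> F" "d b z \<le> \<delta>/2" using F b(4) by (auto simp: finite_net_def)
      have "u *\<^sub>R a + v *\<^sub>R z = a + v *\<^sub>R (z - a)"
        unfolding eq_diff_eq[THEN iffD2, OF b(3)] by (simp add: algebra_simps)
      then have "u *\<^sub>R a + v *\<^sub>R z \<in> T" using z(1) b(1-3) unfolding T_def by fastforce
      moreover have "d x (u *\<^sub>R a + v *\<^sub>R z) \<le> \<delta>/2"
        using z(2) b(1-3) insert.prems unfolding b(5)
        by (intro dist_convex_combination_le) auto
      ultimately show ?thesis by blast
    qed
    from finite_net_thickening[OF N this] show ?thesis by auto
  qed
qed

lemma finite_net_convex_hull:
  assumes "finite_net d \<epsilon> N M" "\<delta> > 0"
  shows "\<exists>N'. finite_net d (\<epsilon> + \<delta>) N' (convex hull M)"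
proof -
  \<comment> \<open>Thickening \<open>convex hull N\<close> rather than \<open>N\<close> gives a
    convex set that still contains \<open>M\<close>, so hull minimality applies.\<close>
  have "convex hull M \<subseteq> {x. \<exists>z\<in>convex hull N. d x z \<le> \<epsilon>}"
    using assms(1) by (intro hull_minimal convex_dist_le_thickening)
      (auto simp: finite_net_def intro: hull_inc)
  then have "\<exists>y\<in>convex hull N. d x y \<le> \<epsilon>" if "x \<in> convex hull M" for x
    using that by blast
  moreover have "finite N" using assms(1) by (simp add: finite_net_def)
  ultimately show ?thesis
    using finite_net_convex_hull_finite[of N \<delta>] assms(2) finite_net_thickening by blast
qed

text \<open>The open \<delta>-ball around a point of the closure meets \<open>A\<close>, so the same
  \<open>N\<close> serves with the radius enlarged by \<delta>.\<close>

lemma finite_net_closure: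
  assumes "finite_net d \<epsilon> N A" "\<delta> > 0"
  shows "finite_net d (\<delta> + \<epsilon>) N (closure A)"
proof (rule finite_net_thickening[OF assms(1)])
  fix x assume "x \<in> closure A"
  moreover have "x \<in> {y. d x y < \<delta>}" using \<open>\<delta> > 0\<close> zero[of x x] by simp
  ultimately have "{y. d x y < \<delta>} \<inter> A \<noteq> {}"
    using open_Int_closure_eq_empty[OF open_dist_less, of x \<delta> A] by blast
  then show "\<exists>y\<in>A. d x y \<le> \<delta>" by fastforce
qed

lemma hausdorff_mnc_convex_hull: "hausdorff_mnc d (convex hull M) = hausdorff_mnc d M"
  by (rule antisym[OF hausdorff_mnc_leI[OF finite_net_convex_hull] hausdorff_mnc_mono[OF hull_subset]])

lemma hausdorff_mnc_closure: "hausdorff_mnc d (closure A) = hausdorff_mnc d A"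
proof (rule antisym[OF hausdorff_mnc_leI hausdorff_mnc_mono[OF closure_subset]])
  fix \<epsilon> \<delta> :: real and N assume "finite_net d \<epsilon> N A" "\<delta> > 0"
  from finite_net_closure[OF this] show "\<exists>N'. finite_net d (\<epsilon> + \<delta>) N' (closure A)"
    by (auto simp: add.commute)
qed

end

theorem theorem4:
  fixes d :: "'a::frechet_space \<Rightarrow> 'a \<Rightarrow> real"
  assumes "translation_invariant d"
    and "metric_inducing_topology d"
    and "\<And>x r. convex (Metric_space.mball UNIV d x r)"
  shows "measure_of_noncompactness (hausdorff_mnc d)
    \<and> (\<forall>M. hausdorff_mnc d (convex hull M) = hausdorff_mnc d M)"
proof -
  interpret convex_invariant_metric d using assms by unfold_locales
  show ?thesis
    \<comment> \<open>The closed convex hull is undone in two stages: first the closure, then the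
      hull.\<close>
    by (simp add: measure_of_noncompactness_def hausdorff_mnc_closure hausdorff_mnc_convex_hull)
qed

end
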